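(* Let $p\ge 2$ be an integer and let $C_n$ be the cycle on $n$ vertices. If $\gamma_p(C_n)>p$, then $r_p(C_n)=2$ if $p=2$ and $n$ is odd; $r_p(C_n)=4$ if $p=2$ and $n$ is even; and $r_p(C_n)=p-2$ if $p\ge 3$.
   Context: For a graph $G=(V,E)$, a set $D\subseteq V$ is a $p$-dominating set if every vertex $x\notin D$ has at least $p$ neighbours in $D$; $\gamma_p(G)$ is the minimum size of a $p$-dominating set. For $B\subseteq E(G^c)$ (edges of the complement), $G+B=(V,E\cup B)$. The $p$-reinforcement number is $r_p(G)=\min\{|B| : B\subseteq E(G^c),\ \gamma_p(G+B)<\gamma_p(G)\}$, with the convention $r_p(G)=0$ if $\gamma_p(G)\le p$. *)

theory Defs
  imports Main
begin

text \<open>A finite simple graph is a pair of its vertex set and its edge set, an edge being the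
  two-element set of its endpoints.\<close>

type_synonym 'a ugraph = "'a set \<times> 'a set set"

definition all_edges :: "'a set \<Rightarrow> 'a set set" where
  "all_edges V = {{x, y} | x y. x \<in> V \<and> y \<in> V \<and> x \<noteq> y}"

definition simple_graph :: "'a ugraph \<Rightarrow> bool" where
  "simple_graph G \<longleftrightarrow> finite (fst G) \<and> snd G \<subseteq> all_edges (fst G)"

definition complement_edges :: "'a ugraph \<Rightarrow> 'a set set" where
  "complement_edges G = all_edges (fst G) - snd G"

definition add_edges :: "'a ugraph \<Rightarrow> 'a set set \<Rightarrow> 'a ugraph" where
  "add_edges G B = (fst G, snd G \<union> B)"

definition p_dominating :: "nat \<Rightarrow> 'a ugraph \<Rightarrow> 'a set \<Rightarrow> bool" where
  "p_dominating p G D \<longleftrightarrow>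
     D \<subseteq> fst G \<and> (\<forall>x \<in> fst G - D. p \<le> card {y \<in> D. {x, y} \<in> snd G})"

definition p_domination_number :: "nat \<Rightarrow> 'a ugraph \<Rightarrow> nat" where
  "p_domination_number p G = Min {card D | D. p_dominating p G D}"

definition p_reinforcement_number :: "nat \<Rightarrow> 'a ugraph \<Rightarrow> nat" where
  "p_reinforcement_number p G =
     (if p_domination_number p G \<le> p then 0
      else Min {card B | B. B \<subseteq> complement_edges G \<and>
                  p_domination_number p (add_edges G B) < p_domination_number p G})"

text \<open>This is the cycle on \<open>n\<close> vertices only for \<open>n \<ge> 3\<close>.\<close>

definition cycle_graph :: "nat \<Rightarrow> nat ugraph" where
  "cycle_graph n = ({..<n}, {{i, (i + 1) mod n} | i. i < n})"

lemma simple_graph_cycle_graph: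
  assumes "n \<ge> 3"
  shows "simple_graph (cycle_graph n)"
proof -
  have "{i, (i + 1) mod n} \<in> all_edges {..<n}" if "i < n" for i
  proof -
    have "(i + 1) mod n \<noteq> i"
      using assms that by (cases "i + 1 = n") auto
    moreover have "(i + 1) mod n < n"
      using assms by simp
    ultimately show ?thesis
      unfolding all_edges_def using that by (metis (mono_tags, lifting) lessThan_iff mem_Collect_eq)
  qed
  then show ?thesis
    by (auto simp: simple_graph_def cycle_graph_def)
qed

end

theory Submission
  imports Defs
begin

text \<open>Let \<open>D\<close> be \<open>p\<close>-dominating in \<open>C\<^sub>n + B\<close>. Every vertex has two neighbours in \<open>C\<^sub>n\<close> and an added
  edge joins at most one pair in \<open>(V - D) \<times> D\<close>, so counting the edges between \<open>V - D\<close> and \<open>D\<close> gives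
  \<open>p (n - |D|) \<le> 2 |D| + |B|\<close>. For \<open>p = 2\<close> this yields both \<open>\<gamma>\<^sub>2(C\<^sub>n) = \<lceil>n/2\<rceil>\<close> and the lower bounds
  on \<open>|B|\<close>, which are attained by adding edges for the even vertices with the last one
  (\<open>n\<close> odd: \<open>n - 1\<close>, \<open>n\<close> even: \<open>n - 2\<close>) removed. For \<open>p \<ge> 3\<close> no vertex of \<open>C\<^sub>n\<close> can be left out of a
  \<open>p\<close>-dominating set, and a vertex that is left out in \<open>C\<^sub>n + B\<close> needs \<open>p - 2\<close> new neighbours.\<close>

section \<open>Domination and reinforcement in general graphs\<close>

lemma finite_p_dominating_cards:
  assumes "finite (fst G)"
  shows "finite {card D | D. p_dominating p G D}"
proof (rule finite_subset)
  show "{card D | D. p_dominating p G D} \<subseteq> card ` Pow (fst G)"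
    by (auto simp: p_dominating_def)
qed (use assms in simp)

lemma p_domination_number_le:
  assumes "finite (fst G)" "p_dominating p G D"
  shows "p_domination_number p G \<le> card D"
  unfolding p_domination_number_def
  using assms by (intro Min_le finite_p_dominating_cards) auto

lemma p_domination_number_attained:
  assumes "finite (fst G)"
  obtains D where "p_dominating p G D" "card D = p_domination_number p G"
proof -
  \<comment> \<open>The whole vertex set dominates vacuously, so \<open>Min\<close> ranges over a
    nonempty set.\<close>
  have "p_dominating p G (fst G)"
    by (simp add: p_dominating_def)
  then have "p_domination_number p G \<in> {card D | D. p_dominating p G D}"
    unfolding p_domination_number_def
    using assms by (intro Min_in finite_p_dominating_cards) auto
  then show ?thesis
    using that by auto
qed

lemma finite_all_edges: "finite V \<Longrightarrow> finite (all_edges V)"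
  by (rule finite_subset[of _ "Pow V"]) (auto simp: all_edges_def)

text \<open>Exhibiting \<open>B\<close> and \<open>D\<close> gives the upper bound. The premise
  \<open>lower\<close> speaks of an arbitrary small dominating set \<open>D'\<close>, so edge counts
  apply to it directly; a minimum dominating set of the enlarged graph serves as
  \<open>D'\<close>.\<close>

lemma p_reinforcement_number_eqI:
  assumes fin: "finite (fst G)" and gt: "p < p_domination_number p G"
    and B: "B \<subseteq> complement_edges G" "card B = r"
    and D: "p_dominating p (add_edges G B) D" "card D < p_domination_number p G"
    and lower: "\<And>B' D'. B' \<subseteq> complement_edges G \<Longrightarrow> p_dominating p (add_edges G B') D' \<Longrightarrow>
                  card D' < p_domination_number p G \<Longrightarrow> r \<le> card B'"
  shows "p_reinforcement_number p G = r"
proof -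
  let ?S = "{card B | B. B \<subseteq> complement_edges G \<and>
               p_domination_number p (add_edges G B) < p_domination_number p G}"
  have fin': "finite (fst (add_edges G B'))" for B'
    using fin by (simp add: add_edges_def)
  have "?S \<subseteq> card ` Pow (complement_edges G)"
    by auto
  moreover have "finite (complement_edges G)"
    using fin by (simp add: complement_edges_def finite_all_edges)
  ultimately have "finite ?S"
    by (meson finite_Pow_iff finite_imageI finite_subset)
  moreover have "r \<in> ?S"
    using B D p_domination_number_le[OF fin' D(1)] by auto
  moreover have "r \<le> s" if s: "s \<in> ?S" for s
  proof -
    obtain B' where B': "B' \<subseteq> complement_edges G" "s = card B'"
      "p_domination_number p (add_edges G B') < p_domination_number p G"
      using s by auto
    then show ?thesis
      using lower p_domination_number_attained[OF fin'] by metis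
  qed
  ultimately have "Min ?S = r"
    by (intro Min_eqI) auto
  then show ?thesis
    using gt by (simp add: p_reinforcement_number_def)
qed

section \<open>Lower bounds on the number of added edges\<close>

lemma p_dominating_edge_count:
  assumes fin: "finite (fst G)" and "finite B"
    and deg: "\<And>y. y \<in> fst G \<Longrightarrow> card {x \<in> fst G. {x, y} \<in> snd G} \<le> d"
    and dom: "p_dominating p (add_edges G B) D"
  shows "p * card (fst G - D) \<le> d * card D + card B"
proof -
  let ?U = "fst G - D"
  have DV: "D \<subseteq> fst G" and ge: "\<And>x. x \<in> ?U \<Longrightarrow> p \<le> card {y \<in> D. {x, y} \<in> snd G \<union> B}"
    using dom by (auto simp: p_dominating_def add_edges_def)
  have fD: "finite D" and fU: "finite ?U"
    using fin DV finite_subset by auto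
  have "p * card ?U \<le> (\<Sum>x\<in>?U. card {y \<in> D. {x, y} \<in> snd G \<union> B})"
    using sum_mono[of ?U "\<lambda>_. p", OF ge] by (simp add: mult.commute)
  also have "\<dots> \<le> (\<Sum>x\<in>?U. card {y \<in> D. {x, y} \<in> snd G} + card {y \<in> D. {x, y} \<in> B})"
  proof (rule sum_mono)
    fix x
    have "{y \<in> D. {x, y} \<in> snd G \<union> B} = {y \<in> D. {x, y} \<in> snd G} \<union> {y \<in> D. {x, y} \<in> B}"
      by auto
    then show "card {y \<in> D. {x, y} \<in> snd G \<union> B}
        \<le> card {y \<in> D. {x, y} \<in> snd G} + card {y \<in> D. {x, y} \<in> B}"
      by (simp only: card_Un_le)
  qed
  also have "\<dots> = (\<Sum>x\<in>?U. card {y \<in> D. {x, y} \<in> snd G}) + (\<Sum>x\<in>?U. card {y \<in> D. {x, y} \<in> B})"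
    by (rule sum.distrib)
  also have "\<dots> \<le> d * card D + card B"
  proof (rule add_mono)
    \<comment> \<open>Old edges are recounted from their ends in \<open>D\<close>, where the degree
      bound \<open>d\<close> gives \<open>d * card D\<close>.\<close>
    have "(\<Sum>x\<in>?U. card {y \<in> D. {x, y} \<in> snd G}) = (\<Sum>y\<in>D. card {x \<in> ?U. {x, y} \<in> snd G})"
      using sum.swap_restrict[OF fU fD, of "\<lambda>_ _. 1::nat" "\<lambda>x y. {x, y} \<in> snd G"] by simp
    also have "\<dots> \<le> (\<Sum>y\<in>D. d)"
    proof (rule sum_mono)
      fix y assume "y \<in> D"
      have "card {x \<in> ?U. {x, y} \<in> snd G} \<le> card {x \<in> fst G. {x, y} \<in> snd G}"
        using fin by (intro card_mono) auto
      then show "card {x \<in> ?U. {x, y} \<in> snd G} \<le> d"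
        using deg DV \<open>y \<in> D\<close> by (meson le_trans subsetD)
    qed
    finally show "(\<Sum>x\<in>?U. card {y \<in> D. {x, y} \<in> snd G}) \<le> d * card D"
      by (simp add: mult.commute)
    have "(\<Sum>x\<in>?U. card {y \<in> D. {x, y} \<in> B}) = card (SIGMA x:?U. {y \<in> D. {x, y} \<in> B})"
      using fU fD by simp
    also have "\<dots> \<le> card B"
    \<comment> \<open>As \<open>x\<close> lies outside \<open>D\<close> and \<open>y\<close> inside,
      the unordered edge determines the pair.\<close>
    proof (rule card_inj_on_le[where f = "\<lambda>(x, y). {x, y}"])
      show "inj_on (\<lambda>(x, y). {x, y}) (SIGMA x:?U. {y \<in> D. {x, y} \<in> B})"
        by (auto simp: inj_on_def doubleton_eq_iff)
    qed (use \<open>finite B\<close> in auto)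
    finally show "(\<Sum>x\<in>?U. card {y \<in> D. {x, y} \<in> B}) \<le> card B" .
  qed
  finally show ?thesis .
qed

text \<open>The same bound at a single left-out vertex: at most \<open>d\<close> of its neighbours
  in \<open>D\<close> are old, and each other one uses up its own edge of \<open>B\<close>.\<close>

lemma p_le_degree_add_card:
  assumes "finite (fst G)" "finite B"
    and deg: "card {y \<in> fst G. {x, y} \<in> snd G} \<le> d"
    and dom: "p_dominating p (add_edges G B) D" and x: "x \<in> fst G - D"
  shows "p \<le> d + card B"
proof -
  have DV: "D \<subseteq> fst G" and ge: "p \<le> card {y \<in> D. {x, y} \<in> snd G \<union> B}"
    using dom x by (auto simp: p_dominating_def add_edges_def)
  have fD: "finite D"
    using DV assms(1) finite_subset by blast
  have "card {y \<in> D. {x, y} \<in> snd G \<union> B}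
      \<le> card ({y \<in> fst G. {x, y} \<in> snd G} \<union> {y \<in> D. {x, y} \<in> B})"
    using DV fD assms(1) by (intro card_mono) auto
  also have "\<dots> \<le> card {y \<in> fst G. {x, y} \<in> snd G} + card {y \<in> D. {x, y} \<in> B}"
    by (rule card_Un_le)
  also have "card {y \<in> D. {x, y} \<in> B} \<le> card B"
    using x \<open>finite B\<close>
    by (intro card_inj_on_le[where f = "\<lambda>y. {x, y}"]) (auto simp: inj_on_def doubleton_eq_iff)
  finally show ?thesis
    using ge deg by linarith
qed

lemma p_dominating_add_edges_empty: "p_dominating p (add_edges G {}) D = p_dominating p G D"
  by (simp add: add_edges_def)

lemma two_le_card_if_two_elements:
  assumes "finite S" "a \<in> S" "b \<in> S" "a \<noteq> b"
  shows "2 \<le> card S"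
  using card_mono[of S "{a, b}"] assms by simp

section \<open>Cycles\<close>

lemma fst_cycle_graph [simp]: "fst (cycle_graph n) = {..<n}"
  by (simp add: cycle_graph_def)

lemma edge_cycle_graph_iff:
  assumes "n \<ge> 3" "x < n" "y < n"
  shows "{x, y} \<in> snd (cycle_graph n) \<longleftrightarrow>
    y = x + 1 \<or> x = y + 1 \<or> x = 0 \<and> y = n - 1 \<or> y = 0 \<and> x = n - 1"
proof -
  have m: "(i + 1) mod n = (if i = n - 1 then 0 else i + 1)" if "i < n" for i
    using that by auto
  have "{x, y} \<in> snd (cycle_graph n) \<longleftrightarrow> y = (x + 1) mod n \<or> x = (y + 1) mod n"
    using assms by (auto simp: cycle_graph_def doubleton_eq_iff)
  also have "\<dots> \<longleftrightarrow> y = x + 1 \<or> x = y + 1 \<or> x = 0 \<and> y = n - 1 \<or> y = 0 \<and> x = n - 1"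
    unfolding m[OF assms(2)] m[OF assms(3)] using assms by (cases "x = n - 1"; cases "y = n - 1") auto
  finally show ?thesis .
qed

lemma degree_cycle_graph:
  assumes "n \<ge> 3" "x < n"
  shows "card {y \<in> fst (cycle_graph n). {x, y} \<in> snd (cycle_graph n)} = 2"
proof -
  let ?a = "if x = n - 1 then 0 else x + 1" and ?b = "if x = 0 then n - 1 else x - 1"
  have "{y \<in> fst (cycle_graph n). {x, y} \<in> snd (cycle_graph n)} = {?a, ?b}"
    using assms by (auto simp: edge_cycle_graph_iff split: if_splits)
  \<comment> \<open>Successor and predecessor differ because \<open>n \<ge> 3\<close>; for
    \<open>n = 2\<close> they would coincide.\<close>
  moreover have "?a \<noteq> ?b"
    using assms by auto
  ultimately show ?thesis
    unfolding card_2_iff by blast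
qed

text \<open>The larger endpoint comes first, as in the edge sets added below; the last premise
  excludes the closing edge of the cycle.\<close>

lemma complement_edges_cycle_graphI:
  assumes "n \<ge> 3" "y + 1 < x" "x < n" "y = 0 \<longrightarrow> x \<noteq> n - 1"
  shows "{x, y} \<in> complement_edges (cycle_graph n)"
proof -
  have "{x, y} \<in> all_edges {..<n}"
    unfolding all_edges_def mem_Collect_eq
    using assms by (intro exI[of _ x] exI[of _ y]) auto
  moreover have "{x, y} \<notin> snd (cycle_graph n)"
    using assms by (subst edge_cycle_graph_iff) auto
  ultimately show ?thesis
    by (simp add: complement_edges_def)
qed

lemma finite_complement_edges_subset:
  "B \<subseteq> complement_edges (cycle_graph n) \<Longrightarrow> finite B"
  by (rule finite_subset[of _ "all_edges {..<n}"])
    (auto simp: complement_edges_def finite_all_edges)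

section \<open>The case \<open>p = 2\<close>\<close>

text \<open>The edge count with \<open>p = d = 2\<close>. An empty \<open>B\<close> bounds the
  domination number from below; a \<open>D\<close> smaller than that number forces \<open>B\<close>
  to be large.\<close>

lemma two_dominating_cycle_graph_card:
  assumes "n \<ge> 3" and "finite B" and dom: "p_dominating 2 (add_edges (cycle_graph n) B) D"
  shows "2 * n \<le> 4 * card D + card B"
proof -
  have DV: "D \<subseteq> {..<n}"
    using dom by (auto simp: p_dominating_def add_edges_def)
  then have "card D \<le> n"
    by (metis card_lessThan card_mono finite_lessThan)
  moreover have "card ({..<n} - D) = n - card D"
    using DV by (simp add: card_Diff_subset finite_subset)
  moreover have "2 * card (fst (cycle_graph n) - D) \<le> 2 * card D + card B"
    using assms degree_cycle_graph[of n]
    by (intro p_dominating_edge_count[OF _ _ _ dom]) (auto simp: insert_commute)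
  ultimately show ?thesis
    by simp
qed

lemma two_domination_number_cycle_graph:
  assumes "n \<ge> 3"
  shows "p_domination_number 2 (cycle_graph n) = (n + 1) div 2"
proof (rule antisym)
  let ?D = "(\<lambda>i. 2 * i) ` {..<(n + 1) div 2}"
  have "p_dominating 2 (cycle_graph n) ?D"
    unfolding p_dominating_def
  proof (intro conjI ballI)
    show "?D \<subseteq> fst (cycle_graph n)"
      by auto
    fix x assume x: "x \<in> fst (cycle_graph n) - ?D"
    have "odd x"
    proof
      assume "even x"
      then obtain i where i: "x = 2 * i" by (elim evenE)
      then have "i < (n + 1) div 2" using x by auto
      then show False using x i by auto
    qed
    then obtain i where i: "x = 2 * i + 1" by (elim oddE)
    \<comment> \<open>The successor of \<open>x\<close> on the cycle; it wraps around to 0 only if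
      \<open>n\<close> is even, since \<open>x\<close> is odd.\<close>
    let ?b = "if x = n - 1 then 0 else x + 1"
    have b: "?b \<in> ?D"
    proof (cases "x = n - 1")
      case True
      then show ?thesis using assms by (auto intro!: image_eqI[of _ _ 0])
    next
      case False
      then show ?thesis using x i by (auto intro!: image_eqI[of _ _ "i + 1"])
    qed
    have "2 * i \<in> ?D"
      using x i by auto
    then show "2 \<le> card {y \<in> ?D. {x, y} \<in> snd (cycle_graph n)}"
      using b x i assms
      by (intro two_le_card_if_two_elements[of _ "2 * i" ?b]) (auto simp: edge_cycle_graph_iff)
  qed
  then have "p_domination_number 2 (cycle_graph n) \<le> card ?D"
    by (intro p_domination_number_le) auto
  also have "card ?D = (n + 1) div 2"
    by (simp add: card_image inj_on_def)
  finally show "p_domination_number 2 (cycle_graph n) \<le> (n + 1) div 2" .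
next
  obtain D where D: "p_dominating 2 (cycle_graph n) D" "card D = p_domination_number 2 (cycle_graph n)"
    using p_domination_number_attained[of "cycle_graph n" 2] by auto
  then show "(n + 1) div 2 \<le> p_domination_number 2 (cycle_graph n)"
    using two_dominating_cycle_graph_card[of n "{}" D] assms
    by (simp add: p_dominating_add_edges_empty)
qed

text \<open>An odd vertex below \<open>2 * k - 1\<close> lies between two of the first
  \<open>k\<close> even vertices, so only the vertices from \<open>2 * k - 1\<close> on need
  checking. Both parities of \<open>n\<close> use this.\<close>

lemma two_dominating_evens_add_edges:
  assumes n: "n \<ge> 3" and k: "2 * k \<le> n"
    and last: "\<And>x. 2 * k - 1 \<le> x \<Longrightarrow> x < n \<Longrightarrow> \<exists>a b. a \<noteq> b \<and> a < k \<and> b < k \<and>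
      {x, 2 * a} \<in> snd (cycle_graph n) \<union> B \<and> {x, 2 * b} \<in> snd (cycle_graph n) \<union> B"
  shows "p_dominating 2 (add_edges (cycle_graph n) B) ((\<lambda>i. 2 * i) ` {..<k})"
  unfolding p_dominating_def
proof (intro conjI ballI)
  let ?D = "(\<lambda>i. 2 * i) ` {..<k}"
  show "?D \<subseteq> fst (add_edges (cycle_graph n) B)"
    using k by (auto simp: add_edges_def)
  fix x assume x: "x \<in> fst (add_edges (cycle_graph n) B) - ?D"
  then have xn: "x < n" by (simp add: add_edges_def)
  have "\<exists>a b. a \<noteq> b \<and> a < k \<and> b < k \<and>
      {x, 2 * a} \<in> snd (cycle_graph n) \<union> B \<and> {x, 2 * b} \<in> snd (cycle_graph n) \<union> B"
  proof (cases "2 * k - 1 \<le> x")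
    case True
    then show ?thesis using last xn by blast
  next
    case False
    have "odd x"
    proof
      assume "even x"
      then obtain i where "x = 2 * i" by (elim evenE)
      then show False using x False by auto
    qed
    then obtain i where i: "x = 2 * i + 1" by (elim oddE)
    show ?thesis
      using False i xn k n by (intro exI[of _ i] exI[of _ "i + 1"]) (auto simp: edge_cycle_graph_iff)
  qed
  then obtain a b where ab: "a \<noteq> b" "a < k" "b < k"
      "{x, 2 * a} \<in> snd (cycle_graph n) \<union> B" "{x, 2 * b} \<in> snd (cycle_graph n) \<union> B"
    by blast
  then show "2 \<le> card {y \<in> ?D. {x, y} \<in> snd (add_edges (cycle_graph n) B)}"
    by (intro two_le_card_if_two_elements[of _ "2 * a" "2 * b"]) (auto simp: add_edges_def)
qed

lemma two_reinforcement_number_cycle_graph_odd: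
  assumes n: "n \<ge> 5" and "odd n"
  shows "p_reinforcement_number 2 (cycle_graph n) = 2"
proof -
  obtain k where k: "n = 2 * k + 1" using \<open>odd n\<close> by (elim oddE)
  \<comment> \<open>Thus 0 and 2 both stay in \<open>?D\<close> as targets for new edges.\<close>
  have k2: "k \<ge> 2" using k n by simp
  have gamma: "p_domination_number 2 (cycle_graph n) = k + 1"
    using two_domination_number_cycle_graph[of n] k n by simp
  \<comment> \<open>Dropping \<open>2 * k\<close> leaves \<open>2 * k - 1\<close> with only
    \<open>2 * k - 2\<close>, and \<open>2 * k\<close> with only 0, as neighbours in
    \<open>?D\<close>. Each needs one new edge.\<close>
  let ?B = "{{2 * k - 1, 0}, {2 * k, 2}}" and ?D = "(\<lambda>i. 2 * i) ` {..<k}"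
  show ?thesis
  proof (rule p_reinforcement_number_eqI)
    show "?B \<subseteq> complement_edges (cycle_graph n)"
      using k k2 by (auto intro!: complement_edges_cycle_graphI)
    show "card ?B = 2"
      using k2 by (simp add: doubleton_eq_iff)
    show "p_dominating 2 (add_edges (cycle_graph n) ?B) ?D"
    proof (rule two_dominating_evens_add_edges)
      fix x assume "2 * k - 1 \<le> x" "x < n"
      then consider "x = 2 * k - 1" | "x = 2 * k" using k by linarith
      then show "\<exists>a b. a \<noteq> b \<and> a < k \<and> b < k \<and>
        {x, 2 * a} \<in> snd (cycle_graph n) \<union> ?B \<and> {x, 2 * b} \<in> snd (cycle_graph n) \<union> ?B"
      proof cases
        case 1
        then show ?thesis
          using k k2 by (intro exI[of _ 0] exI[of _ "k - 1"]) (auto simp: edge_cycle_graph_iff)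
      next
        case 2
        then show ?thesis
          using k k2 by (intro exI[of _ 0] exI[of _ 1]) (auto simp: edge_cycle_graph_iff)
      qed
    qed (use n k in auto)
    show "card ?D < p_domination_number 2 (cycle_graph n)"
      using gamma by (simp add: card_image inj_on_def)
    \<comment> \<open>Since \<open>card D' \<le> k\<close>, the count reads
      \<open>4 * k + 2 \<le> 4 * k + card B'\<close>.\<close>
    show "2 \<le> card B'" if "B' \<subseteq> complement_edges (cycle_graph n)"
      "p_dominating 2 (add_edges (cycle_graph n) B') D'"
      "card D' < p_domination_number 2 (cycle_graph n)" for B' D'
      using two_dominating_cycle_graph_card[OF _ finite_complement_edges_subset[OF that(1)] that(2)]
        that(3) gamma n k by simp
  qed (use gamma k2 in auto)
qed

lemma two_reinforcement_number_cycle_graph_even: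
  assumes n: "n \<ge> 5" and "even n"
  shows "p_reinforcement_number 2 (cycle_graph n) = 4"
proof -
  obtain m where m: "n = 2 * m" using \<open>even n\<close> by (elim evenE)
  define k where "k = m - 1"
  have k: "n = 2 * k + 2" using m n by (simp add: k_def)
  have k2: "k \<ge> 2" using k n by simp
  have gamma: "p_domination_number 2 (cycle_graph n) = k + 1"
    using two_domination_number_cycle_graph[of n] k n by simp
  \<comment> \<open>Dropping \<open>2 * k\<close> leaves it no neighbour in \<open>?D\<close>, so it
    needs two new edges; \<open>2 * k - 1\<close> and \<open>2 * k + 1\<close> keep only
    \<open>2 * k - 2\<close> and 0 respectively and need one each.\<close>
  let ?B = "{{2 * k - 1, 0}, {2 * k, 0}, {2 * k, 2}, {2 * k + 1, 2}}"
    and ?D = "(\<lambda>i. 2 * i) ` {..<k}"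
  show ?thesis
  proof (rule p_reinforcement_number_eqI)
    show "?B \<subseteq> complement_edges (cycle_graph n)"
      using k k2 by (auto intro!: complement_edges_cycle_graphI)
    show "card ?B = 4"
      using k2 by (simp add: doubleton_eq_iff)
    show "p_dominating 2 (add_edges (cycle_graph n) ?B) ?D"
    proof (rule two_dominating_evens_add_edges)
      fix x assume "2 * k - 1 \<le> x" "x < n"
      then consider "x = 2 * k - 1" | "x = 2 * k" | "x = 2 * k + 1" using k by linarith
      then show "\<exists>a b. a \<noteq> b \<and> a < k \<and> b < k \<and>
        {x, 2 * a} \<in> snd (cycle_graph n) \<union> ?B \<and> {x, 2 * b} \<in> snd (cycle_graph n) \<union> ?B"
      proof cases
        case 1
        then have "{x, 2 * (k - 1)} \<in> snd (cycle_graph n)"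
          using k k2 by (subst edge_cycle_graph_iff) auto
        then show ?thesis
          using 1 k2 by (intro exI[of _ 0] exI[of _ "k - 1"]) simp
      next
        case 2
        then show ?thesis
          using k2 by (intro exI[of _ 0] exI[of _ 1]) auto
      next
        case 3
        then have "{x, 0} \<in> snd (cycle_graph n)"
          using k k2 by (subst edge_cycle_graph_iff) auto
        then show ?thesis
          using 3 k2 by (intro exI[of _ 0] exI[of _ 1]) simp
      qed
    qed (use n k in auto)
    show "card ?D < p_domination_number 2 (cycle_graph n)"
      using gamma by (simp add: card_image inj_on_def)
    \<comment> \<open>Now \<open>2 * n = 4 * k + 4\<close>, while still
      \<open>card D' \<le> k\<close>.\<close>
    show "4 \<le> card B'" if "B' \<subseteq> complement_edges (cycle_graph n)"
      "p_dominating 2 (add_edges (cycle_graph n) B') D'"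
      "card D' < p_domination_number 2 (cycle_graph n)" for B' D'
      using two_dominating_cycle_graph_card[OF _ finite_complement_edges_subset[OF that(1)] that(2)]
        that(3) gamma n k by simp
  qed (use gamma k2 in auto)
qed

section \<open>The case \<open>p \<ge> 3\<close>\<close>

lemma p_domination_number_cycle_graph_ge_3:
  assumes n: "n \<ge> 3" and p: "p \<ge> 3"
  shows "p_domination_number p (cycle_graph n) = n"
proof -
  obtain D where D: "p_dominating p (cycle_graph n) D" "card D = p_domination_number p (cycle_graph n)"
    using p_domination_number_attained[of "cycle_graph n" p] by auto
  have "D = {..<n}"
  proof (rule ccontr)
    assume "D \<noteq> {..<n}"
    then obtain x where x: "x \<in> fst (cycle_graph n) - D"
      using D(1) by (auto simp: p_dominating_def)
    \<comment> \<open>With no edges added, a left-out vertex would need \<open>p\<close> neighbours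
      but has degree 2.\<close>
    then have "p \<le> 2 + card ({} :: nat set set)"
      using D(1) n degree_cycle_graph[of n x] by (intro p_le_degree_add_card[OF _ _ _ _ x])
        (auto simp: p_dominating_add_edges_empty)
    then show False using p by simp
  qed
  then show ?thesis using D by simp
qed

lemma p_reinforcement_number_cycle_graph_ge_3:
  assumes n: "n > p" and p: "p \<ge> 3"
  shows "p_reinforcement_number p (cycle_graph n) = p - 2"
proof -
  have gamma: "p_domination_number p (cycle_graph n) = n"
    using p_domination_number_cycle_graph_ge_3 assms by simp
  \<comment> \<open>Only 0 is left out. Its cycle neighbours 1 and \<open>n - 1\<close> are in
    \<open>?D\<close>, and the edges to \<open>2, ..., p - 1\<close> supply the missing
    \<open>p - 2\<close>.\<close>
  let ?B = "(\<lambda>y. {y, 0}) ` {2..<p}" and ?D = "{1..<n}"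
  show ?thesis
  proof (rule p_reinforcement_number_eqI)
    show "?B \<subseteq> complement_edges (cycle_graph n)"
      using assms by (auto intro!: complement_edges_cycle_graphI)
    show "card ?B = p - 2"
      by (subst card_image) (auto simp: inj_on_def doubleton_eq_iff)
    show "p_dominating p (add_edges (cycle_graph n) ?B) ?D"
      unfolding p_dominating_def
    proof (intro conjI ballI)
      show "?D \<subseteq> fst (add_edges (cycle_graph n) ?B)"
        by (auto simp: add_edges_def)
      fix x assume "x \<in> fst (add_edges (cycle_graph n) ?B) - ?D"
      then have x: "x = 0"
        by (auto simp: add_edges_def)
      have nb: "{0, y} \<in> snd (cycle_graph n) \<union> ?B" if "y \<in> {1..<p} \<union> {n - 1}" for y
      proof (cases "y \<in> {2..<p}")
        case True
        then show ?thesis by (auto simp: insert_commute)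
      next
        case False
        then have "y = 1 \<or> y = n - 1" using that by auto
        then show ?thesis using assms by (auto simp: edge_cycle_graph_iff)
      qed
      \<comment> \<open>From \<open>n > p\<close> follows \<open>n - 1 \<ge> p\<close>, so the union
        is disjoint.\<close>
      have "p = card ({1..<p} \<union> {n - 1})"
        using assms by (subst card_Un_disjoint) auto
      also have "\<dots> \<le> card {y \<in> ?D. {x, y} \<in> snd (cycle_graph n) \<union> ?B}"
      proof (rule card_mono)
        have "{1..<p} \<union> {n - 1} \<subseteq> ?D"
          using assms by auto
        then show "{1..<p} \<union> {n - 1} \<subseteq> {y \<in> ?D. {x, y} \<in> snd (cycle_graph n) \<union> ?B}"
          using nb x by blast
      qed simp
      finally show "p \<le> card {y \<in> ?D. {x, y} \<in> snd (add_edges (cycle_graph n) ?B)}"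
        by (simp add: add_edges_def)
    qed
    show "card ?D < p_domination_number p (cycle_graph n)"
      using gamma assms by simp
    show "p - 2 \<le> card B'" if B': "B' \<subseteq> complement_edges (cycle_graph n)"
      and D': "p_dominating p (add_edges (cycle_graph n) B') D'"
      and less: "card D' < p_domination_number p (cycle_graph n)" for B' D'
    proof -
      have "D' \<noteq> {..<n}" using less gamma by auto
      then obtain x where x: "x \<in> fst (cycle_graph n) - D'"
        using D' by (auto simp: p_dominating_def add_edges_def)
      then have "p \<le> 2 + card B'"
        using D' assms finite_complement_edges_subset[OF B'] degree_cycle_graph[of n x]
        by (intro p_le_degree_add_card[OF _ _ _ _ x]) auto
      then show ?thesis by simp
    qed
  qed (use gamma assms in auto)
qed

theorem theorem3p3:
  fixes p n :: nat
  assumes "p \<ge> 2" and "n \<ge> 3"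
    and "p_domination_number p (cycle_graph n) > p"
  shows "(p = 2 \<and> odd n \<longrightarrow> p_reinforcement_number p (cycle_graph n) = 2) \<and>
         (p = 2 \<and> even n \<longrightarrow> p_reinforcement_number p (cycle_graph n) = 4) \<and>
         (p \<ge> 3 \<longrightarrow> p_reinforcement_number p (cycle_graph n) = p - 2)"
proof -
  \<comment> \<open>The hypothesis reads \<open>(n + 1) div 2 > 2\<close> here, and
    \<open>n > p\<close> in the other case.\<close>
  have "n \<ge> 5" if "p = 2"
    using assms that two_domination_number_cycle_graph[of n] by simp
  moreover have "n > p" if "p \<ge> 3"
    using assms that p_domination_number_cycle_graph_ge_3 by simp
  ultimately show ?thesis
    using two_reinforcement_number_cycle_graph_odd two_reinforcement_number_cycle_graph_even
      p_reinforcement_number_cycle_graph_ge_3 by blast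
qed

end
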